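(* Let $$f_r(X^1,\ldots,X^K,Q)=\ell(\Phi_r(X^1,\ldots,X^K),Q)+\lambda\sum_{i=1}^r g(X^1_i,\ldots,X^K_i)+H(Q),$$ with $\phi,\Phi_r,g,\ell,H,\lambda$ satisfying the definitions and assumptions listed in the context. If $r>\mathrm{card}(D)$, then from any point $(Z^1,\ldots,Z^K,Q)$, with $(Z^1,\ldots,Z^K)$ a size-$r$ set of $K$ factors, such that $f_r(Z^1,\ldots,Z^K,Q)<\infty$, there must exist a non-increasing path (i.e. a path along which the value of $f_r$ does not increase) from $(Z^1,\ldots,Z^K,Q)$ to a global minimizer of $f_r$.
   Context: Tensor notation: $D, D^1,\ldots,D^K$ are multi-indices of dimensions; for $D=d_1\times\cdots\times d_N$, $\mathbb{R}^D=\mathbb{R}^{d_1\times\cdots\times d_N}$ and $\mathrm{card}(D)=\prod_{i=1}^N d_i$. A size-$r$ set of $K$ factors $(X^1,\ldots,X^K)_r$ is an element of $\mathbb{R}^{D^1\times r}\times\cdots\times\mathbb{R}^{D^K\times r}$; $X^k_i\in\mathbb{R}^{D^k}$ is the $i$-th slice of $X^k$ along its last dimension. A function $\theta$ of several tensor arguments is positively homogeneous with degree $p$ if $\theta(\alpha x^1,\ldots,\alpha x^N)=\alpha^p\theta(x^1,\ldots,x^N)$ for all $\alpha\ge 0$ (in particular it vanishes at $0$ when $p\neq0$). It is positive semidefinite if it vanishes at $(0,\ldots,0)$ and is nonnegative everywhere. Elemental mapping: $\phi:\mathbb{R}^{D^1}\times\cdots\times\mathbb{R}^{D^K}\to\mathbb{R}^D$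 is any mapping that is positively homogeneous with some degree $p\neq 0$. The $r$-element factorization mapping is $\Phi_r(X^1,\ldots,X^K)=\sum_{i=1}^r\phi(X^1_i,\ldots,X^K_i)$. Elemental regularization function: $g:\mathbb{R}^{D^1}\times\cdots\times\mathbb{R}^{D^K}\to\mathbb{R}_+\cup\{\infty\}$ is any positive semidefinite, positively homogeneous function. $(\phi,g)$ is a nondegenerate pair if (1) $g$ and $\phi$ are both positively homogeneous with the same degree $p$, for some $p\ne0$, and (2) for every $X\in\mathrm{Im}(\phi)\setminus\{0\}$ there exist $\mu\in(0,\infty]$ and $(\tilde z^1,\ldots,\tilde z^K)$ such that $\phi(\tilde z^1,\ldots,\tilde z^K)=X$, $g(\tilde z^1,\ldots,\tilde z^K)=\mu$, and $g(z^1,\ldots,z^K)\ge\mu$ for all $(z^1,\ldots,z^K)$ with $\phi(z^1,\ldots,z^K)=X$. Factorization regularization function: for $X\in\mathbb{R}^D$, $$\Omega_{\phi,g}(X)=\inf_{r\in\mathbb{N}_+}\ \inf_{(X^1,\ldots,X^K)_r}\Big\{\sum_{i=1}^r g(X^1_i,\ldots,X^K_i)\ :\ \Phi_r(X^1,\ldots,X^K)=X\Big\},$$ with $\Omega_{\phi,g}(X)=\infty$ if $X\notin\bigcup_r\mathrm{Im}(\Phi_r)$. Standing assumptions: $Q$ ranges over a finite-dimensional real vector space $E$ (additional non-factorized variables); $\ell:\mathbb{R}^D\times E\to\mathbb{R}$ is once differentiable and jointly convex in $(X,Q)$; $H:E\to\mathbb{R}$ is convex (possibly non-differentiable); $(\phi,g)$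 is a nondegenerate pair; $\lambda>0$; and the convex function $F(X,Q)=\ell(X,Q)+\lambda\Omega_{\phi,g}(X)+H(Q)$ attains its minimum over $\mathbb{R}^D\times E$.
   Formalization: It is also assumed that, at the X-part of some minimizer (X,Q) of F, the infimum defining Ω_{φ,g}(X) is attained by a factorization of some finite size; without this f_r can fail to have a global minimizer. The degree p is taken positive, so that α^p makes sense at α=0. *)

theory Defs
  imports "HOL-Analysis.Analysis"
begin

text \<open>
  The output space \<open>\<real>\<^sup>D\<close> is \<^typ>\<open>real ^ 'd\<close>, where the finite type \<open>'d\<close> is the set of
  multi-indices of \<open>D = d\<^sub>1 \<times> \<dots> \<times> d\<^sub>N\<close> (for example a product of \<open>N\<close> numeral types), so that
  \<open>card D\<close> is \<open>CARD('d)\<close>.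

  The factor spaces have \<open>K\<close> unrelated shapes, and their last dimension \<open>r\<close> is quantified over in
  the definition of \<open>Omega\<close>. They are therefore carrier sets: a tensor of shape
  \<open>D = [d\<^sub>1, \<dots>, d\<^sub>N]\<close> is a function on index lists that vanishes outside the (0-based)
  multi-indices of \<open>D\<close>. On these carriers the product topology of the function space is the
  Euclidean topology.
\<close>

type_synonym tensor = "nat list \<Rightarrow> real"

definition multi_indices :: "nat list \<Rightarrow> nat list set" where
  "multi_indices D = {js. list_all2 (<) js D}"

definition tensors :: "nat list \<Rightarrow> tensor set" where
  "tensors D = {x. \<forall>js. js \<notin> multi_indices D \<longrightarrow> x js = 0}"

text \<open>\<open>factor_tuples Ds\<close> is \<open>\<real>\<^bsup>D\<^sup>1\<^esup> \<times> \<dots> \<times> \<real>\<^bsup>D\<^sup>K\<^esup>\<close> for the list \<open>Ds\<close> of the \<open>K\<close> shapes.\<close>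

definition factor_tuples :: "nat list list \<Rightarrow> (nat \<Rightarrow> tensor) set" where
  "factor_tuples Ds =
     {z. (\<forall>k<length Ds. z k \<in> tensors (Ds ! k)) \<and> (\<forall>k\<ge>length Ds. z k = (\<lambda>_. 0))}"

definition zero_tuple :: "nat \<Rightarrow> tensor" where
  "zero_tuple = (\<lambda>_ _. 0)"

definition scale_tuple :: "real \<Rightarrow> (nat \<Rightarrow> tensor) \<Rightarrow> (nat \<Rightarrow> tensor)" where
  "scale_tuple \<alpha> z = (\<lambda>k js. \<alpha> * z k js)"

definition factor_sets :: "nat list list \<Rightarrow> nat \<Rightarrow> (nat \<Rightarrow> tensor) set" where
  "factor_sets Ds r = factor_tuples (map (\<lambda>D. D @ [r]) Ds)"

definition slice :: "nat \<Rightarrow> (nat \<Rightarrow> tensor) \<Rightarrow> (nat \<Rightarrow> tensor)" where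
  "slice i Z = (\<lambda>k js. Z k (js @ [i]))"

text \<open>
  The scaling law is required for all \<open>\<alpha> \<ge> 0\<close>. At \<open>\<alpha> = 0\<close> it involves \<open>0\<^sup>p\<close>, which is a number
  only for \<open>p \<ge> 0\<close>, with \<open>0\<^sup>0 = 1\<close>; Isabelle's total function has \<open>0 powr p = 0\<close> for every \<open>p\<close>, so both
  points are spelled out. The parameter \<open>act\<close> is multiplication by a nonnegative real in the
  codomain.
\<close>

definition pos_homogeneous ::
  "nat list list \<Rightarrow> (real \<Rightarrow> 'v \<Rightarrow> 'v) \<Rightarrow> real \<Rightarrow> ((nat \<Rightarrow> tensor) \<Rightarrow> 'v) \<Rightarrow> bool" where
  "pos_homogeneous Ds act p \<theta> \<longleftrightarrow>
     0 \<le> p \<and>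
     (\<forall>\<alpha>\<ge>0. \<forall>z\<in>factor_tuples Ds.
        \<theta> (scale_tuple \<alpha> z) = act (if p = 0 then 1 else \<alpha> powr p) (\<theta> z))"

definition elemental_mapping ::
  "nat list list \<Rightarrow> ((nat \<Rightarrow> tensor) \<Rightarrow> real ^ 'd) \<Rightarrow> bool" where
  "elemental_mapping Ds \<phi> \<longleftrightarrow> (\<exists>p. p \<noteq> 0 \<and> pos_homogeneous Ds scaleR p \<phi>)"

text \<open>Nonnegativity of a regularizer is expressed by its codomain \<^typ>\<open>ennreal\<close>, i.e. \<open>[0,\<infinity>]\<close>.\<close>

definition elemental_regularizer ::
  "nat list list \<Rightarrow> ((nat \<Rightarrow> tensor) \<Rightarrow> ennreal) \<Rightarrow> bool" where
  "elemental_regularizer Ds g \<longleftrightarrow>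
     g zero_tuple = 0 \<and> (\<exists>p. pos_homogeneous Ds (\<lambda>c y. ennreal c * y) p g)"

definition nondegenerate_pair ::
  "nat list list \<Rightarrow> ((nat \<Rightarrow> tensor) \<Rightarrow> real ^ 'd) \<Rightarrow> ((nat \<Rightarrow> tensor) \<Rightarrow> ennreal) \<Rightarrow> bool" where
  "nondegenerate_pair Ds \<phi> g \<longleftrightarrow>
     (\<exists>p. p \<noteq> 0 \<and> pos_homogeneous Ds (\<lambda>c y. ennreal c * y) p g \<and> pos_homogeneous Ds scaleR p \<phi>) \<and>
     (\<forall>X \<in> \<phi> ` factor_tuples Ds - {0}.
        \<exists>\<mu>>0. \<exists>z'\<in>factor_tuples Ds.
          \<phi> z' = X \<and> g z' = \<mu> \<and> (\<forall>z\<in>factor_tuples Ds. \<phi> z = X \<longrightarrow> \<mu> \<le> g z))"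

definition Phi ::
  "((nat \<Rightarrow> tensor) \<Rightarrow> real ^ 'd) \<Rightarrow> nat \<Rightarrow> (nat \<Rightarrow> tensor) \<Rightarrow> real ^ 'd" where
  "Phi \<phi> r Z = (\<Sum>i<r. \<phi> (slice i Z))"

definition sum_reg ::
  "((nat \<Rightarrow> tensor) \<Rightarrow> ennreal) \<Rightarrow> nat \<Rightarrow> (nat \<Rightarrow> tensor) \<Rightarrow> ennreal" where
  "sum_reg g r Z = (\<Sum>i<r. g (slice i Z))"

text \<open>An infimum over the empty set is \<open>\<infinity>\<close> in \<^typ>\<open>ennreal\<close>, as wanted for \<open>X\<close> without a
  factorization.\<close>

definition Omega ::
  "nat list list \<Rightarrow> ((nat \<Rightarrow> tensor) \<Rightarrow> real ^ 'd) \<Rightarrow> ((nat \<Rightarrow> tensor) \<Rightarrow> ennreal) \<Rightarrow>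
   real ^ 'd \<Rightarrow> ennreal" where
  "Omega Ds \<phi> g X =
     (INF r\<in>{1..}. INF Z\<in>{Z \<in> factor_sets Ds r. Phi \<phi> r Z = X}. sum_reg g r Z)"

text \<open>
  Nondegeneracy makes every single fibre of \<open>\<phi>\<close> attain its infimum of \<open>g\<close>, but since \<open>g\<close> need not be
  lower semicontinuous it does not make the infimum in \<open>Omega\<close> attained: with \<open>\<phi>\<close> the identity of
  \<open>\<real>\<^sup>2\<close> and \<open>g x\<close> equal to \<open>2 * norm x\<close> on the first axis and \<open>norm x\<close> elsewhere, \<open>Omega\<close> is the
  norm, which is not attained on the first axis. Attainment is therefore a separate notion.
\<close>

definition Omega_attained ::
  "nat list list \<Rightarrow> ((nat \<Rightarrow> tensor) \<Rightarrow> real ^ 'd) \<Rightarrow> ((nat \<Rightarrow> tensor) \<Rightarrow> ennreal) \<Rightarrow>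
   real ^ 'd \<Rightarrow> bool" where
  "Omega_attained Ds \<phi> g X \<longleftrightarrow>
     (\<exists>r\<ge>1. \<exists>Z\<in>factor_sets Ds r. Phi \<phi> r Z = X \<and> sum_reg g r Z = Omega Ds \<phi> g X)"

definition convex_objective ::
  "nat list list \<Rightarrow> ((nat \<Rightarrow> tensor) \<Rightarrow> real ^ 'd) \<Rightarrow> ((nat \<Rightarrow> tensor) \<Rightarrow> ennreal) \<Rightarrow>
   ((real ^ 'd) \<times> 'e \<Rightarrow> real) \<Rightarrow> real \<Rightarrow> ('e \<Rightarrow> real) \<Rightarrow> (real ^ 'd) \<times> 'e \<Rightarrow> ereal" where
  "convex_objective Ds \<phi> g l lam H = (\<lambda>(X, Q).
     ereal (l (X, Q)) + ereal lam * enn2ereal (Omega Ds \<phi> g X) + ereal (H Q))"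

definition factor_objective ::
  "((nat \<Rightarrow> tensor) \<Rightarrow> real ^ 'd) \<Rightarrow> ((nat \<Rightarrow> tensor) \<Rightarrow> ennreal) \<Rightarrow>
   ((real ^ 'd) \<times> 'e \<Rightarrow> real) \<Rightarrow> real \<Rightarrow> ('e \<Rightarrow> real) \<Rightarrow> nat \<Rightarrow> (nat \<Rightarrow> tensor) \<times> 'e \<Rightarrow> ereal" where
  "factor_objective \<phi> g l lam H r = (\<lambda>(Z, Q).
     ereal (l (Phi \<phi> r Z, Q)) + ereal lam * enn2ereal (sum_reg g r Z) + ereal (H Q))"

definition global_minimizer_on :: "('a \<Rightarrow> ereal) \<Rightarrow> 'a set \<Rightarrow> 'a \<Rightarrow> bool" where
  "global_minimizer_on f S x \<longleftrightarrow> x \<in> S \<and> (\<forall>y\<in>S. f x \<le> f y)"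

definition nonincreasing_path_in ::
  "('a::topological_space \<Rightarrow> ereal) \<Rightarrow> 'a set \<Rightarrow> (real \<Rightarrow> 'a) \<Rightarrow> bool" where
  "nonincreasing_path_in f S \<gamma> \<longleftrightarrow>
     path \<gamma> \<and> path_image \<gamma> \<subseteq> S \<and> antimono_on {0..1} (f \<circ> \<gamma>)"

end

theory Submission
  imports Defs
begin

text \<open>
  Call a factor tuple \<open>z\<close> an atom. Scaling it by \<open>u powr (1 / p)\<close> scales both \<open>\<phi> z\<close> and \<open>g z\<close> by \<open>u\<close>,
  because the two maps have the same degree \<open>p > 0\<close>. So once finitely many atoms are fixed, a factor
  set of size \<open>r\<close> is a nonnegative weight vector \<open>c\<close> with at most \<open>r\<close> nonzero entries; its output
  \<open>X\<close> and its regularizer \<open>\<rho>\<close> are linear in \<open>c\<close>, and the objective is a convex function of \<open>X\<close>, \<open>\<rho>\<close>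
  and \<open>Q\<close> that increases with \<open>\<rho>\<close>. The atoms to take are the slices of the starting point \<open>Z\<close> and
  those of a factorization \<open>W\<close> of \<open>Xmin\<close> that attains \<open>Omega\<close>. Since \<open>F\<close> bounds every factorized
  objective from below, the weights of \<open>W\<close> give the least value, and with unlimited slots the straight
  segment from the weights of \<open>Z\<close> to those of \<open>W\<close> would do: a convex function does not increase on the
  way to its minimum.

  With \<open>r > CARD('d)\<close> slots the segment is replaced by a polygon, in the manner of a parametric simplex
  method. Let \<open>k\<close> run from \<open>1\<close> (start) to \<open>0\<close> (end) and let \<open>(X, Q)\<close> move linearly with \<open>k\<close>.
  By convexity an edge from \<open>(k, \<rho>)\<close> to \<open>(k', \<rho>')\<close> with \<open>k' \<le> k\<close> does not increase the objective as soon
  as it does not run above the line from \<open>(k, \<rho>)\<close> to \<open>(0, \<rho>\<^sub>0)\<close>, where \<open>\<rho>\<^sub>0\<close> is the regularizer of \<open>W\<close>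
  (\<open>moving_toward_minimum_descends\<close>). From weights with linearly independent support such an edge exists
  that uses at most \<open>CARD('d) + 1\<close> atoms (\<open>pivot\<close>): either \<open>\<rho>\<close> can be lowered at fixed \<open>X\<close>, or \<open>k\<close> can be
  lowered until a weight vanishes. Finitely many such edges lead to \<open>k = 0\<close> (\<open>pivoting_reaches_end\<close>),
  since \<open>k\<close> can only stop at finitely many values and, for each of them, independent supports allow
  finitely many weight vectors. Finally \<open>reweighting_descends\<close> turns an edge into a path of factor
  sets. An atom that enters takes over a slot whose slice is zero, so \<open>\<phi>\<close> and \<open>g\<close> are only ever
  evaluated along rays, where homogeneity determines them.
\<close>

section \<open>Conic combinations of weighted atoms\<close>

lemma ratio_test:
  fixes c b :: "'j \<Rightarrow> real"
  assumes "finite N" "N \<noteq> {}" "\<And>j. j \<in> N \<Longrightarrow> b j < 0" "\<And>j. j \<in> N \<Longrightarrow> 0 < c j"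
  shows "\<exists>t>0. (\<forall>j\<in>N. 0 \<le> c j + t * b j) \<and> (\<exists>j\<in>N. c j + t * b j = 0)"
proof -
  define t where "t = Min ((\<lambda>j. c j / - b j) ` N)"
  have fin: "finite ((\<lambda>j. c j / - b j) ` N)" "(\<lambda>j. c j / - b j) ` N \<noteq> {}"
    using assms by auto
  obtain i where i: "i \<in> N" "t = c i / - b i"
    using Min_in[OF fin] unfolding t_def by blast
  have le: "t \<le> c j / - b j" if "j \<in> N" for j
    unfolding t_def using fin that by auto
  have "0 < t"
    using i assms(3,4)[of i] by (simp add: divide_pos_neg)
  moreover have "0 \<le> c j + t * b j" if "j \<in> N" for j
    using le[OF that] assms(3)[OF that] by (simp add: field_simps)
  moreover have "c i + t * b i = 0"
    using i assms(3)[of i] by simp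
  ultimately show ?thesis
    using i by blast
qed

text \<open>
  The atom \<open>j\<close> contributes \<open>u j *\<^sub>R a j\<close> to the output and \<open>u j * w j\<close> to the regularizer. Weight
  vectors \<open>u\<close> may be signed, since differences of weights serve as directions.
\<close>

locale weighted_atoms =
  fixes J :: "'j set" and a :: "'j \<Rightarrow> 'v::euclidean_space" and w :: "'j \<Rightarrow> real"
  assumes finite_atoms: "finite J"
    and weight_nonneg: "\<And>j. j \<in> J \<Longrightarrow> 0 \<le> w j"
begin

definition supp :: "('j \<Rightarrow> real) \<Rightarrow> 'j set" where
  "supp u = {j \<in> J. u j \<noteq> 0}"

definition lincomb :: "('j \<Rightarrow> real) \<Rightarrow> 'v" where
  "lincomb u = (\<Sum>j\<in>J. u j *\<^sub>R a j)"

definition cost :: "('j \<Rightarrow> real) \<Rightarrow> real" where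
  "cost u = (\<Sum>j\<in>J. u j * w j)"

definition coefficients :: "('j \<Rightarrow> real) set" where
  "coefficients = {c. (\<forall>j\<in>J. 0 \<le> c j) \<and> (\<forall>j. j \<notin> J \<longrightarrow> c j = 0)}"

text \<open>
  Linear independence of the family \<open>a\<close> on \<open>S\<close>; unlike \<open>independent (a ` S)\<close> it forbids repeated
  values, so that weights supported in \<open>S\<close> are determined by their combination.
\<close>

definition free :: "'j set \<Rightarrow> bool" where
  "free S \<longleftrightarrow> (\<forall>u. supp u \<subseteq> S \<and> lincomb u = 0 \<longrightarrow> supp u = {})"

lemma lincomb_add_scaled: "lincomb (\<lambda>j. u j + t * v j) = lincomb u + t *\<^sub>R lincomb v"
  by (simp add: lincomb_def scaleR_add_left sum.distrib scaleR_sum_right)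

lemma cost_add_scaled: "cost (\<lambda>j. u j + t * v j) = cost u + t * cost v"
  by (simp add: cost_def distrib_right sum.distrib sum_distrib_left mult.assoc)

lemma lincomb_convex: "lincomb (\<lambda>j. (1 - t) * c j + t * c' j) = (1 - t) *\<^sub>R lincomb c + t *\<^sub>R lincomb c'"
  by (simp add: lincomb_def scaleR_add_left sum.distrib scaleR_sum_right)

lemma cost_convex: "cost (\<lambda>j. (1 - t) * c j + t * c' j) = (1 - t) * cost c + t * cost c'"
  by (simp add: cost_def distrib_right sum.distrib sum_distrib_left mult.assoc)

lemma finite_supp: "finite (supp u)"
  using finite_atoms by (simp add: supp_def)

lemma supp_subset: "supp u \<subseteq> J"
  by (auto simp: supp_def)

lemma free_empty: "free {}"
  by (simp add: free_def)

lemma free_unique: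
  assumes "free S" "supp u \<subseteq> S" "supp v \<subseteq> S" "lincomb u = lincomb v" "j \<in> J"
  shows "u j = v j"
proof -
  let ?d = "\<lambda>j. u j + (-1) * v j"
  have "supp ?d \<subseteq> supp u \<union> supp v"
    by (auto simp: supp_def)
  moreover have "lincomb ?d = 0"
    unfolding lincomb_add_scaled using assms(4) by simp
  ultimately have "supp ?d = {}"
    using assms(1-3) unfolding free_def by blast
  then show ?thesis
    using assms(5) by (auto simp: supp_def)
qed

lemma free_card_le:
  assumes "free S" "S \<subseteq> J"
  shows "card S \<le> DIM('v)"
proof -
  have fin: "finite S"
    using assms(2) finite_atoms by (rule finite_subset)
  have inj: "inj_on a S"
  proof (rule inj_onI)
    fix i j assume ij: "i \<in> S" "j \<in> S" "a i = a j"
    let ?e = "\<lambda>i k. if k = i then 1 else 0 :: real"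
    have tot: "lincomb (?e k) = a k" if "k \<in> S" for k
    proof -
      have "k \<in> J" using that assms(2) by auto
      moreover have "?e k j *\<^sub>R a j = (if k = j then a j else 0)" for j
        by auto
      ultimately show ?thesis
        unfolding lincomb_def using finite_atoms by (simp add: sum.delta')
    qed
    have sup: "supp (?e k) \<subseteq> S" if "k \<in> S" for k
      using that by (auto simp: supp_def)
    have "?e i i = ?e j i"
      by (rule free_unique[OF assms(1) sup[OF ij(1)] sup[OF ij(2)]]) (use tot ij assms(2) in auto)
    then show "i = j"
      by (simp split: if_splits)
  qed
  have "independent (a ` S)"
    unfolding dependent_finite[OF finite_imageI[OF fin]]
  proof (intro notI, elim exE conjE bexE)
    fix u v assume u: "(\<Sum>v\<in>a ` S. u v *\<^sub>R v) = 0" and v: "v \<in> a ` S" "u v \<noteq> 0"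
    let ?u = "\<lambda>j. if j \<in> S then u (a j) else 0"
    have "lincomb ?u = (\<Sum>j\<in>S. ?u j *\<^sub>R a j)"
      unfolding lincomb_def by (rule sum.mono_neutral_right) (use finite_atoms assms(2) in auto)
    also have "\<dots> = (\<Sum>v\<in>a ` S. u v *\<^sub>R v)"
      by (simp add: sum.reindex[OF inj])
    finally have "lincomb ?u = 0"
      using u by simp
    moreover have "supp ?u \<subseteq> S"
      by (auto simp: supp_def)
    ultimately have "supp ?u = {}"
      using assms(1) unfolding free_def by blast
    then show False
      using v assms(2) by (auto simp: supp_def)
  qed
  then have "card (a ` S) \<le> DIM('v)"
    by (rule independent_card_le)
  then show ?thesis
    by (simp add: card_image[OF inj])
qed

lemma cost_nonneg:
  assumes "\<And>j. j \<in> J \<Longrightarrow> 0 \<le> u j" shows "0 \<le> cost u"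
  unfolding cost_def using assms weight_nonneg by (intro sum_nonneg) auto

text \<open>
  A dependency and its negative cannot both be costly. When the cost is zero, the remaining freedom of
  sign provides a negative entry outside the independent set \<open>S\<close>, so that moving along \<open>b\<close> will make
  an entry outside \<open>S\<close> vanish.
\<close>

lemma dependency_not_costly:
  assumes "free S" "\<not> free T"
  obtains b where "supp b \<subseteq> T" "lincomb b = 0" "cost b < 0 \<or> (cost b = 0 \<and> (\<exists>j\<in>supp b - S. b j < 0))"
proof -
  obtain b where b: "supp b \<subseteq> T" "lincomb b = 0" "supp b \<noteq> {}"
    using assms(2) unfolding free_def by blast
  let ?n = "\<lambda>j. 0 + (-1) * b j"
  have n: "supp ?n = supp b" "lincomb ?n = 0" "cost ?n = - cost b"
    unfolding lincomb_add_scaled cost_add_scaled using b(2)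
    by (auto simp: supp_def lincomb_def cost_def)
  obtain j where j: "j \<in> supp b - S"
    using assms(1) b(2,3) unfolding free_def by blast
  consider "cost b < 0" | "cost b > 0" | "cost b = 0" "b j < 0" | "cost b = 0" "b j > 0"
    using j by (fastforce simp: supp_def)
  then show ?thesis
  proof cases
    case 2 then show ?thesis using that[of ?n] n b by auto
  next
    case 4
    then have "\<exists>j\<in>supp ?n - S. ?n j < 0"
      using j n(1) by (intro bexI[of _ j]) auto
    then show ?thesis using that[of ?n] n b 4 by auto
  qed (use that b j in auto)
qed

text \<open>
  Caratheodory's reduction, with the cost kept under control: among the cheap representations inside the
  support of \<open>c\<close>, one with the smallest support is independent, because a dependency could be
  subtracted until a further weight vanishes.
\<close>

lemma free_representation:
  assumes "c \<in> coefficients"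
  obtains c' where "c' \<in> coefficients" "supp c' \<subseteq> supp c" "free (supp c')"
    "lincomb c' = lincomb c" "cost c' \<le> cost c"
proof -
  define P where "P c' \<longleftrightarrow> c' \<in> coefficients \<and> supp c' \<subseteq> supp c \<and> lincomb c' = lincomb c \<and> cost c' \<le> cost c"
    for c'
  have "P c"
    using assms by (simp add: P_def)
  then obtain c' where c': "P c'" and least: "\<And>d. P d \<Longrightarrow> card (supp c') \<le> card (supp d)"
    using ex_has_least_nat[of P c "\<lambda>c. card (supp c)"] by blast
  have "free (supp c')"
  proof (rule ccontr)
    assume "\<not> free (supp c')"
    then obtain b where b: "supp b \<subseteq> supp c'" "lincomb b = 0"
      and neg: "cost b < 0 \<or> (cost b = 0 \<and> (\<exists>j\<in>supp b - {}. b j < 0))"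
      using dependency_not_costly[OF free_empty] by metis
    define N where "N = {j \<in> J. b j < 0}"
    have "N \<noteq> {}"
      using neg cost_nonneg[of b] by (force simp: N_def supp_def)
    moreover have pos: "0 < c' j" if "j \<in> N" for j
      using that b(1) c' by (force simp: N_def supp_def P_def coefficients_def order_less_le)
    moreover have "finite N" "\<And>j. j \<in> N \<Longrightarrow> b j < 0"
      using finite_atoms by (auto simp: N_def)
    ultimately obtain t i where t: "t > 0" "\<And>j. j \<in> N \<Longrightarrow> 0 \<le> c' j + t * b j"
      and i: "i \<in> N" "c' i + t * b i = 0"
      using ratio_test[of N b c'] by metis
    define d where "d = (\<lambda>j. if j \<in> J then c' j + t * b j else 0)"
    have d_eq: "lincomb d = lincomb (\<lambda>j. c' j + t * b j)" "cost d = cost (\<lambda>j. c' j + t * b j)"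
      by (auto simp: d_def lincomb_def cost_def intro: sum.cong)
    have "0 \<le> d j" if "j \<in> J" for j
      using t that c' by (cases "j \<in> N") (auto simp: d_def N_def P_def coefficients_def)
    then have "d \<in> coefficients"
      by (simp add: coefficients_def d_def)
    moreover have "supp d \<subseteq> supp c'"
      using b(1) by (auto simp: supp_def d_def)
    moreover have "t * cost b \<le> 0"
      using t(1) neg by (auto simp: mult_le_0_iff)
    ultimately have "P d"
      using c' b(2) unfolding P_def d_eq lincomb_add_scaled cost_add_scaled by auto
    moreover have "i \<in> supp c' - supp d"
      using i pos[of i] by (auto simp: supp_def d_def N_def)
    then have "card (supp d) < card (supp c')"
      using \<open>supp d \<subseteq> supp c'\<close> by (intro psubset_card_mono finite_supp) auto
    ultimately show False
      using least by fastforce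
  qed
  then show ?thesis
    using that c' by (auto simp: P_def)
qed

section \<open>Pivoting to an optimal combination\<close>

text \<open>
  The direction \<open>d - c\<close> would lead to the target weights \<open>d\<close>, but it may involve too many atoms. Among the
  directions that are as good, take one that brings in the fewest new atoms. If its support together with
  that of \<open>c\<close> is dependent, then a dependency \<open>b\<close> lives on an independent set plus one more atom. Either
  \<open>b\<close> can be used to remove a new atom from the direction, against minimality, or \<open>b\<close> is nonnegative on
  all new atoms, and then \<open>b\<close> itself is a feasible direction that lowers the cost and keeps
  the combination.
\<close>

lemma pivot:
  assumes c: "c \<in> coefficients" "free (supp c)" and d: "d \<in> coefficients"
  obtains
    (cheaper) c' where "c' \<in> coefficients" "card (supp c \<union> supp c') \<le> Suc DIM('v)"
      "lincomb c' = lincomb c" "cost c' < cost c"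
  | (forward) e where "\<And>j. j \<notin> J \<Longrightarrow> e j = 0" "\<And>j. j \<in> J - supp c \<Longrightarrow> 0 \<le> e j"
      "lincomb e = lincomb d - lincomb c" "cost e \<le> cost d - cost c" "free (supp c \<union> supp e)"
proof -
  define P where "P e \<longleftrightarrow> (\<forall>j. j \<notin> J \<longrightarrow> e j = 0) \<and> (\<forall>j\<in>J - supp c. 0 \<le> e j) \<and>
      lincomb e = lincomb d - lincomb c \<and> cost e \<le> cost d - cost c" for e
  have "P (\<lambda>j. d j + (-1) * c j)"
    using c d unfolding P_def lincomb_add_scaled cost_add_scaled
    by (auto simp: coefficients_def supp_def)
  then obtain e where e: "P e"
    and least: "\<And>f. P f \<Longrightarrow> card (supp e - supp c) \<le> card (supp f - supp c)"
    using ex_has_least_nat[of P _ "\<lambda>e. card (supp e - supp c)"] by blast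
  show ?thesis
  proof (cases "free (supp c \<union> supp e)")
    case True
    then show ?thesis
      using forward[of e] e by (auto simp: P_def)
  next
    case False
    \<comment> \<open>A maximal independent set needs only one more atom to become dependent, hence the bound \<open>Suc DIM\<close>.\<close>
    define F where "F = {T. supp c \<subseteq> T \<and> T \<subseteq> supp c \<union> supp e \<and> free T}"
    have "F \<subseteq> Pow (supp c \<union> supp e)" "supp c \<in> F"
      using c(2) by (auto simp: F_def)
    then have F: "finite F" "F \<noteq> {}"
      using finite_subset finite_supp by blast+
    from finite_has_maximal[OF F] obtain T
      where "T \<in> F" and max: "\<And>U. U \<in> F \<Longrightarrow> T \<subseteq> U \<Longrightarrow> T = U"
      by blast
    then have T: "supp c \<subseteq> T" "T \<subseteq> supp c \<union> supp e" "free T"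
      by (auto simp: F_def)
    have "T \<noteq> supp c \<union> supp e"
      using False T(3) by metis
    then obtain k where k: "k \<in> supp c \<union> supp e" "k \<notin> T"
      using T(2) by blast
    have "\<not> free (insert k T)"
      using max[of "insert k T"] k T by (auto simp: F_def)
    then obtain b where b: "supp b \<subseteq> insert k T" "lincomb b = 0"
      and neg: "cost b < 0 \<or> (cost b = 0 \<and> (\<exists>j\<in>supp b - supp c. b j < 0))"
      using dependency_not_costly[OF c(2)] by metis
    have TJ: "T \<subseteq> J"
      using T supp_subset[of c] supp_subset[of e] by blast
    have "card (insert k T) \<le> Suc DIM('v)"
      using free_card_le[of T] T TJ finite_subset[OF TJ finite_atoms] k by simp
    then have card_le: "card U \<le> Suc DIM('v)" if "U \<subseteq> insert k T" for U
      using card_mono[OF _ that] finite_subset[OF TJ finite_atoms] by auto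
    show ?thesis
    proof (cases "\<exists>j\<in>J - supp c. b j < 0")
      case True
      define N where "N = {j \<in> J - supp c. b j < 0}"
      have pos: "0 < e j" if "j \<in> N" for j
      proof -
        have "j \<in> supp b" using that by (auto simp: N_def supp_def)
        then have "j \<in> supp e" using that b(1) k T by (auto simp: N_def)
        then show ?thesis
          using e that by (auto simp: N_def P_def supp_def order_less_le)
      qed
      have "finite N" "N \<noteq> {}" "\<And>j. j \<in> N \<Longrightarrow> b j < 0"
        using finite_atoms True by (auto simp: N_def)
      then obtain t i where t: "t > 0" "\<And>j. j \<in> N \<Longrightarrow> 0 \<le> e j + t * b j"
        and i: "i \<in> N" "e i + t * b i = 0"
        using ratio_test[of N b e] pos by metis
      define f where "f = (\<lambda>j. if j \<in> J then e j + t * b j else 0)"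
      have f_eq: "lincomb f = lincomb (\<lambda>j. e j + t * b j)" "cost f = cost (\<lambda>j. e j + t * b j)"
        by (auto simp: f_def lincomb_def cost_def intro: sum.cong)
      have "0 \<le> f j" if "j \<in> J - supp c" for j
        using t that e by (cases "j \<in> N") (auto simp: f_def N_def P_def)
      moreover have "t * cost b \<le> 0"
        using t(1) neg by (auto simp: mult_le_0_iff)
      ultimately have "P f"
        using e b(2) unfolding P_def f_eq lincomb_add_scaled cost_add_scaled by (auto simp: f_def)
      moreover have "supp f - supp c \<subseteq> supp e - supp c"
      proof
        fix j assume j: "j \<in> supp f - supp c"
        then have "j \<in> supp e \<or> j \<in> supp b"
          by (auto simp: supp_def f_def)
        then show "j \<in> supp e - supp c"
          using j b(1) k T by auto
      qed
      moreover have "i \<in> (supp e - supp c) - (supp f - supp c)"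
        using i pos[of i] by (auto simp: supp_def f_def N_def)
      ultimately have "card (supp f - supp c) < card (supp e - supp c)"
        by (intro psubset_card_mono) (use finite_supp in auto)
      then show ?thesis
        using least[OF \<open>P f\<close>] by simp
    next
      case False
      then have "cost b < 0"
        using neg by (auto simp: supp_def)
      define N where "N = {j \<in> J. b j < 0}"
      have "N \<noteq> {}"
        using \<open>cost b < 0\<close> cost_nonneg[of b] by (force simp: N_def)
      moreover have "0 < c j" if "j \<in> N" for j
        using that False c(1) by (auto simp: N_def coefficients_def supp_def order_less_le)
      moreover have "finite N" "\<And>j. j \<in> N \<Longrightarrow> b j < 0"
        using finite_atoms by (auto simp: N_def)
      ultimately obtain t where t: "t > 0" "\<And>j. j \<in> N \<Longrightarrow> 0 \<le> c j + t * b j"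
        using ratio_test[of N b c] by metis
      define c' where "c' = (\<lambda>j. if j \<in> J then c j + t * b j else 0)"
      have eq: "lincomb c' = lincomb (\<lambda>j. c j + t * b j)" "cost c' = cost (\<lambda>j. c j + t * b j)"
        by (auto simp: c'_def lincomb_def cost_def intro: sum.cong)
      have "0 \<le> c' j" if "j \<in> J" for j
        using t that c by (cases "j \<in> N") (auto simp: c'_def N_def coefficients_def)
      then have "c' \<in> coefficients"
        by (simp add: coefficients_def c'_def)
      moreover have "supp c \<union> supp c' \<subseteq> supp c \<union> supp b"
        by (auto simp: supp_def c'_def)
      then have "card (supp c \<union> supp c') \<le> Suc DIM('v)"
        using b(1) T by (intro card_le) auto
      moreover have "lincomb c' = lincomb c" "cost c' < cost c"
        unfolding eq lincomb_add_scaled cost_add_scaled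
        using b(2) t(1) \<open>cost b < 0\<close> by (auto simp: mult_pos_neg)
      ultimately show ?thesis
        using cheaper by blast
    qed
  qed
qed

text \<open>
  Follow a direction from \<open>pivot\<close> until its end or until a weight \<open>i\<close> vanishes. In the second case
  \<open>lincomb e\<close> is not a combination of the atoms that remain, since its only representation on the
  independent set \<open>supp c \<union> supp e\<close> has a nonzero entry at \<open>i\<close>.
\<close>

lemma advance:
  assumes c: "c \<in> coefficients"
    and e: "\<And>j. j \<notin> J \<Longrightarrow> e j = 0" "\<And>j. j \<in> J - supp c \<Longrightarrow> 0 \<le> e j"
    and fr: "free (supp c \<union> supp e)"
  obtains t where "0 < t" "t \<le> 1" "(\<lambda>j. c j + t * e j) \<in> coefficients"
    "t = 1 \<or> (\<forall>u. supp u \<subseteq> supp (\<lambda>j. c j + t * e j) \<longrightarrow> lincomb u \<noteq> lincomb e)"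
proof (cases "(\<lambda>j. c j + 1 * e j) \<in> coefficients")
  case True
  then show ?thesis
    using that[of 1] by simp
next
  case False
  define N where "N = {j \<in> J. e j < 0}"
  have pos: "0 < c j" if "j \<in> N" for j
    using that e(2)[of j] c by (force simp: N_def coefficients_def supp_def order_less_le)
  obtain k where k: "k \<in> J" "c k + e k < 0"
    using False c e(1) by (auto simp: coefficients_def not_le)
  then have kN: "k \<in> N"
    using c by (force simp: N_def coefficients_def)
  then have "finite N" "N \<noteq> {}" "\<And>j. j \<in> N \<Longrightarrow> e j < 0"
    using finite_atoms by (auto simp: N_def)
  then obtain t i where t: "t > 0" "\<And>j. j \<in> N \<Longrightarrow> 0 \<le> c j + t * e j"
    and i: "i \<in> N" "c i + t * e i = 0"
    using ratio_test[of N e c] pos by metis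
  have "t \<le> 1"
  proof (rule ccontr)
    assume "\<not> t \<le> 1"
    then have "t * e k \<le> 1 * e k"
      using kN by (intro mult_right_mono_neg) (auto simp: N_def)
    then show False
      using t(2)[OF kN] k by simp
  qed
  moreover have "0 \<le> c j + t * e j" if "j \<in> J" for j
    using t c that by (cases "j \<in> N") (auto simp: N_def coefficients_def)
  then have "(\<lambda>j. c j + t * e j) \<in> coefficients"
    using c e(1) by (simp add: coefficients_def)
  moreover have "lincomb u \<noteq> lincomb e" if u: "supp u \<subseteq> supp (\<lambda>j. c j + t * e j)" for u
  proof
    assume "lincomb u = lincomb e"
    moreover have "supp u \<subseteq> supp c \<union> supp e"
      using u by (auto simp: supp_def)
    ultimately have "u i = e i"
      using free_unique[OF fr, of u e i] i by (auto simp: N_def)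
    then show False
      using i u by (auto simp: N_def supp_def)
  qed
  ultimately show ?thesis
    using that t(1) by blast
qed

text \<open>
  The parameter \<open>k\<close> is the part of the way to the target combination \<open>x\<close> that is still left, and \<open>R k c\<close>
  stands for reachability. A move must not raise the ratio \<open>(cost c - cost d) / k\<close>, written without
  division so that \<open>k' = 0\<close> makes sense; there it says \<open>cost c' \<le> cost d\<close>.
\<close>

lemma pivoting_reaches_end:
  fixes R :: "real \<Rightarrow> ('j \<Rightarrow> real) \<Rightarrow> bool" and x v :: 'v
  assumes start: "R 1 c0" "c0 \<in> coefficients" "lincomb c0 = x - v" "card (supp c0) \<le> r"
    and target: "d \<in> coefficients" "lincomb d = x"
    and dim: "DIM('v) < r"
    and move: "\<And>k c k' c'. R k c \<Longrightarrow> c \<in> coefficients \<Longrightarrow> lincomb c = x - k *\<^sub>R v \<Longrightarrow>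
      c' \<in> coefficients \<Longrightarrow> lincomb c' = x - k' *\<^sub>R v \<Longrightarrow> card (supp c \<union> supp c') \<le> r \<Longrightarrow>
      0 < k \<Longrightarrow> 0 \<le> k' \<Longrightarrow> k' \<le> k \<Longrightarrow>
      (cost c' - cost d) * k \<le> (cost c - cost d) * k' \<Longrightarrow> R k' c'"
  obtains c where "R 0 c" "c \<in> coefficients" "lincomb c = x" "cost c \<le> cost d"
proof -
  define hit where "hit S y \<longleftrightarrow> (\<exists>u. supp u \<subseteq> S \<and> lincomb u = y)" for S y
  \<comment> \<open>Besides the start, \<open>K\<close> collects the values of \<open>k\<close> at which \<open>advance\<close> can get stuck: a line with direction \<open>v\<close> meets a
      subspace that does not contain \<open>v\<close> in at most one point, and there are finitely many supports.\<close>
  define K where "K = {1} \<union> (\<Union>S\<in>{S \<in> Pow J. \<not> hit S v}. {k. hit S (x - k *\<^sub>R v)})"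
  have unique: "k = k'" if "\<not> hit S v" "hit S (x - k *\<^sub>R v)" "hit S (x - k' *\<^sub>R v)" for S k k'
  proof (rule ccontr)
    assume ne: "k \<noteq> k'"
    obtain u u' where u: "supp u \<subseteq> S" "lincomb u = x - k *\<^sub>R v" "supp u' \<subseteq> S" "lincomb u' = x - k' *\<^sub>R v"
      using \<open>hit S (x - k *\<^sub>R v)\<close> \<open>hit S (x - k' *\<^sub>R v)\<close> unfolding hit_def by blast
    let ?z = "\<lambda>j. 0 + (1 / (k' - k)) * (u j + (-1) * u' j)"
    have "lincomb ?z = lincomb (\<lambda>_. 0) + (1 / (k' - k)) *\<^sub>R (lincomb u + (-1) *\<^sub>R lincomb u')"
      unfolding lincomb_add_scaled ..
    also have "\<dots> = (1 / (k' - k)) *\<^sub>R ((k' - k) *\<^sub>R v)"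
      unfolding u by (simp add: lincomb_def scaleR_diff_left)
    also have "\<dots> = v"
      using ne by simp
    finally have "lincomb ?z = v" .
    moreover have "supp ?z \<subseteq> supp u \<union> supp u'"
      by (auto simp: supp_def)
    ultimately show False
      using \<open>\<not> hit S v\<close> u unfolding hit_def by blast
  qed
  have "finite {k. hit S (x - k *\<^sub>R v)}" if "\<not> hit S v" for S
  proof (cases "\<exists>k. hit S (x - k *\<^sub>R v)")
    case True
    then obtain k where "hit S (x - k *\<^sub>R v)" ..
    then have "{k. hit S (x - k *\<^sub>R v)} \<subseteq> {k}"
      using unique[OF that] by blast
    then show ?thesis by (rule finite_subset) simp
  qed simp
  then have finite_K: "finite K"
    unfolding K_def using finite_atoms by auto
  \<comment> \<open>The reachable states at which to look for an extremal one. Weights with free support are determined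
      by \<open>k\<close> and their support, so \<open>V\<close> is finite.\<close>
  define V where "V = {(k, c). R k c \<and> c \<in> coefficients \<and> lincomb c = x - k *\<^sub>R v \<and>
      free (supp c) \<and> k \<in> K \<and> 0 < k}"
  have V_D: "R k c" "c \<in> coefficients" "lincomb c = x - k *\<^sub>R v" "free (supp c)" "k \<in> K" "0 < k"
    if "(k, c) \<in> V" for k c
    using that by (auto simp: V_def)
  have enter_V: "\<exists>c''. (k', c'') \<in> V \<and> cost c'' \<le> cost c'"
    if "R k' c'" "c' \<in> coefficients" "lincomb c' = x - k' *\<^sub>R v" "card (supp c') \<le> r" "k' \<in> K" "0 < k'"
    for k' c'
  proof -
    obtain c'' where c'': "c'' \<in> coefficients" "supp c'' \<subseteq> supp c'" "free (supp c'')"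
        "lincomb c'' = lincomb c'" "cost c'' \<le> cost c'"
      using free_representation[OF \<open>c' \<in> coefficients\<close>] .
    have "R k' c''"
    proof (rule move[of k' c' c'' k'])
      show "card (supp c' \<union> supp c'') \<le> r"
        using c''(2) that(4) by (simp add: Un_absorb2)
    qed (use c'' that in auto)
    then show ?thesis
      using c'' that by (auto simp: V_def)
  qed
  have inj: "inj_on (map_prod id supp) V"
  proof (rule inj_onI, clarsimp)
    fix k c c' assume c: "(k, c) \<in> V" "(k, c') \<in> V" "supp c = supp c'"
    have "c j = c' j" for j
      using free_unique[of "supp c" c c' j] V_D(2-4)[OF c(1)] V_D(2-4)[OF c(2)] c(3)
      by (cases "j \<in> J") (auto simp: coefficients_def)
    then show "c = c'" by blast
  qed
  have "map_prod id supp ` V \<subseteq> K \<times> Pow J"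
    using supp_subset by (auto simp: V_def)
  then have finite_V: "finite V"
    using inj finite_K finite_atoms by (metis finite_imageD finite_subset finite_cartesian_product finite_Pow_iff)
  have "\<exists>c. (1, c) \<in> V"
    using enter_V[of 1 c0] start by (auto simp: K_def)
  then have "fst ` V \<noteq> {}" by blast
  \<comment> \<open>Take \<open>k\<close> least possible, then the cost: a pivot from there can only end at \<open>k = 0\<close>.\<close>
  define k where "k = Min (fst ` V)"
  have k_le: "k \<le> k'" if "(k', c') \<in> V" for k' c'
    unfolding k_def using finite_V that by (force intro!: Min_le)
  have "k \<in> fst ` V"
    unfolding k_def using finite_V \<open>fst ` V \<noteq> {}\<close> by (intro Min_in) auto
  then have "finite {c. (k, c) \<in> V}" "{c. (k, c) \<in> V} \<noteq> {}"
    using finite_V finite_subset[of "{c. (k, c) \<in> V}" "snd ` V"] by force+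
  then obtain c where cV: "(k, c) \<in> V" and c_le: "\<And>c'. (k, c') \<in> V \<Longrightarrow> cost c \<le> cost c'"
    using ex_is_arg_min_if_finite[of "{c. (k, c) \<in> V}" cost]
    by (auto simp: is_arg_min_linorder)
  note c = V_D[OF cV]
  show ?thesis
  proof (cases rule: pivot[OF c(2) c(4) target(1)])
    case (1 c')
    have R': "R k c'"
    proof (rule move[of k c c' k])
      show "(cost c' - cost d) * k \<le> (cost c - cost d) * k"
        using 1 c by (intro mult_right_mono) auto
    qed (use 1 c dim in auto)
    have "card (supp c') \<le> card (supp c \<union> supp c')"
      by (intro card_mono) (auto simp: finite_supp)
    then obtain c'' where "(k, c'') \<in> V" "cost c'' \<le> cost c'"
      using enter_V[OF R'] 1 c dim by auto
    then show ?thesis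
      using c_le[of c''] 1 by auto
  next
    case (2 e)
    obtain t where t: "0 < t" "t \<le> 1" and ct: "(\<lambda>j. c j + t * e j) \<in> coefficients"
      and stop: "t = 1 \<or> (\<forall>u. supp u \<subseteq> supp (\<lambda>j. c j + t * e j) \<longrightarrow> lincomb u \<noteq> lincomb e)"
      using advance[OF c(2) 2(1,2,5)] by blast
    define c' where "c' = (\<lambda>j. c j + t * e j)"
    define k' where "k' = (1 - t) * k"
    have tot_e: "lincomb e = k *\<^sub>R v"
      using 2(3) target(2) c(3) by simp
    have tot: "lincomb c' = x - k' *\<^sub>R v"
      unfolding c'_def lincomb_add_scaled tot_e c(3) k'_def by (simp add: algebra_simps)
    have k': "0 \<le> k'" "k' < k"
      using t c(6) by (auto simp: k'_def)
    have costc': "cost c' - cost d \<le> (1 - t) * (cost c - cost d)"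
    proof -
      have "t * cost e \<le> t * (cost d - cost c)"
        using t 2(4) by (intro mult_left_mono) auto
      then show ?thesis
        unfolding c'_def cost_add_scaled by (simp add: algebra_simps)
    qed
    have sub: "supp c \<union> supp c' \<subseteq> supp c \<union> supp e"
      by (auto simp: supp_def c'_def)
    have "card (supp c \<union> supp c') \<le> card (supp c \<union> supp e)"
      using sub by (intro card_mono) (auto simp: finite_supp)
    also have "\<dots> \<le> DIM('v)"
      using free_card_le[OF 2(5)] supp_subset by auto
    finally have card: "card (supp c \<union> supp c') \<le> DIM('v)" .
    have R': "R k' c'"
    proof (rule move[of k c c' k'])
      show "(cost c' - cost d) * k \<le> (cost c - cost d) * k'"
        using mult_right_mono[OF costc', of k] c(6) by (simp add: k'_def algebra_simps)
    qed (use c ct tot card dim k' in \<open>auto simp: c'_def\<close>)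
    show ?thesis
    proof (cases "t = 1")
      case True
      then show ?thesis
        using that[of c'] R' tot ct costc' by (simp add: k'_def c'_def)
    next
      case False
      then have "0 < k'"
        using t c(6) by (simp add: k'_def)
      have "\<not> hit (supp c') v"
      proof
        assume "hit (supp c') v"
        then obtain u where u: "supp u \<subseteq> supp c'" "lincomb u = v"
          unfolding hit_def by blast
        have "lincomb (\<lambda>j. 0 + k * u j) = lincomb e"
          unfolding lincomb_add_scaled tot_e using u by (simp add: lincomb_def)
        moreover have "supp (\<lambda>j. 0 + k * u j) \<subseteq> supp c'"
          using u by (auto simp: supp_def)
        ultimately show False
          using stop False unfolding c'_def by blast
      qed
      moreover have "hit (supp c') (x - k' *\<^sub>R v)"
        unfolding hit_def using tot by blast
      ultimately have "k' \<in> K"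
        unfolding K_def using supp_subset[of c'] by blast
      moreover have "card (supp c') \<le> card (supp c \<union> supp c')"
        by (intro card_mono) (auto simp: finite_supp)
      ultimately obtain c'' where "(k', c'') \<in> V"
        using enter_V[OF R'] ct tot card dim \<open>0 < k'\<close> by (auto simp: c'_def)
      then show ?thesis
        using k_le[of k' c''] k' by simp
    qed
  qed
qed

end

section \<open>Factor sets as stacks of slices\<close>

definition stack :: "nat \<Rightarrow> (nat \<Rightarrow> nat \<Rightarrow> tensor) \<Rightarrow> nat \<Rightarrow> tensor" where
  "stack r y = (\<lambda>k js. if js \<noteq> [] \<and> last js < r then y (last js) k (butlast js) else 0)"

lemma snoc_in_multi_indices: "js @ [i] \<in> multi_indices (D @ [r]) \<longleftrightarrow> js \<in> multi_indices D \<and> i < r"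
  by (cases "length js = length D")
    (auto simp: multi_indices_def list_all2_append dest: list_all2_lengthD)

lemma multi_indices_snoc_not_Nil: "[] \<notin> multi_indices (D @ [r])"
  by (simp add: multi_indices_def)

lemma slice_stack: "i < r \<Longrightarrow> slice i (stack r y) = y i"
  by (simp add: slice_def stack_def)

lemma stack_in_factor_sets:
  assumes "\<And>i. i < r \<Longrightarrow> y i \<in> factor_tuples Ds"
  shows "stack r y \<in> factor_sets Ds r"
proof -
  have "stack r y k js = 0" if "k < length Ds" "js \<notin> multi_indices (Ds ! k @ [r])" for k js
  proof (cases js rule: rev_cases)
    case (snoc js' i)
    then show ?thesis
      using that assms[of i] snoc_in_multi_indices[of js' i "Ds ! k" r]
      by (auto simp: stack_def factor_tuples_def tensors_def)
  qed (simp add: stack_def)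
  moreover have "stack r y k = (\<lambda>_. 0)" if "length Ds \<le> k" for k
    using assms that by (auto simp: stack_def factor_tuples_def fun_eq_iff)
  ultimately show ?thesis
    by (simp add: factor_sets_def factor_tuples_def tensors_def)
qed

lemma slice_in_factor_tuples:
  assumes "Z \<in> factor_sets Ds r" "i < r"
  shows "slice i Z \<in> factor_tuples Ds"
  using assms by (auto simp: factor_sets_def factor_tuples_def tensors_def slice_def
      snoc_in_multi_indices)

lemma stack_slices:
  assumes "Z \<in> factor_sets Ds r"
  shows "stack r (\<lambda>i. slice i Z) = Z"
proof (intro ext)
  fix k js
  show "stack r (\<lambda>i. slice i Z) k js = Z k js"
  proof (cases js rule: rev_cases)
    case Nil
    then show ?thesis
      using assms multi_indices_snoc_not_Nil
      by (cases "k < length Ds") (auto simp: stack_def factor_sets_def factor_tuples_def tensors_def)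
  next
    case (snoc js' i)
    then show ?thesis
      using assms snoc_in_multi_indices[of js' i "Ds ! k" r]
      by (cases "k < length Ds")
        (auto simp: stack_def slice_def factor_sets_def factor_tuples_def tensors_def)
  qed
qed

lemma scale_in_factor_tuples: "z \<in> factor_tuples Ds \<Longrightarrow> scale_tuple \<alpha> z \<in> factor_tuples Ds"
  by (auto simp: factor_tuples_def tensors_def scale_tuple_def)

text \<open>
  Root scaling turns homogeneity into linearity on rays, also at \<open>u = 0\<close>, where \<open>0 powr (1 / p) = 0\<close>.
\<close>

lemma pos_homogeneous_root:
  assumes "pos_homogeneous Ds act p \<theta>" "0 < p" "z \<in> factor_tuples Ds" "0 \<le> u"
  shows "\<theta> (scale_tuple (u powr (1 / p)) z) = act u (\<theta> z)"
proof -
  have "(u powr (1 / p)) powr p = u"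
    using assms by (simp add: powr_powr)
  then show ?thesis
    using assms unfolding pos_homogeneous_def by simp
qed

section \<open>The objectives and non-increasing paths\<close>

lemma Omega_le_sum_reg:
  assumes "Z \<in> factor_sets Ds r" "1 \<le> r"
  shows "Omega Ds \<phi> g (Phi \<phi> r Z) \<le> sum_reg g r Z"
  unfolding Omega_def using assms by (auto intro!: INF_lower2[of r] INF_lower2[of Z])

lemma convex_objective_le_factor_objective:
  assumes "Z \<in> factor_sets Ds r" "1 \<le> r" "0 < lam"
  shows "convex_objective Ds \<phi> g l lam H (Phi \<phi> r Z, Q) \<le> factor_objective \<phi> g l lam H r (Z, Q)"
proof -
  have "enn2ereal (Omega Ds \<phi> g (Phi \<phi> r Z)) \<le> enn2ereal (sum_reg g r Z)"
    using Omega_le_sum_reg[OF assms(1,2)] by (simp add: less_eq_ennreal.rep_eq)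
  then show ?thesis
    unfolding convex_objective_def factor_objective_def using assms(3)
    by (auto intro!: add_mono ereal_mult_left_mono)
qed

definition descends_to :: "('a::topological_space \<Rightarrow> ereal) \<Rightarrow> 'a set \<Rightarrow> 'a \<Rightarrow> 'a \<Rightarrow> bool" where
  "descends_to f S x y \<longleftrightarrow>
     (\<exists>\<gamma>. nonincreasing_path_in f S \<gamma> \<and> pathstart \<gamma> = x \<and> pathfinish \<gamma> = y)"

lemma descends_to_refl: "x \<in> S \<Longrightarrow> descends_to f S x x"
  unfolding descends_to_def nonincreasing_path_in_def
  by (rule exI[of _ "\<lambda>_. x"])
    (auto simp: path_def path_image_def pathstart_def pathfinish_def monotone_on_def)

lemma antimono_on_joinpaths:
  assumes 1: "antimono_on {0..1} (f \<circ> \<gamma>1)" and 2: "antimono_on {0..1} (f \<circ> \<gamma>2)"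
    and join: "pathfinish \<gamma>1 = pathstart \<gamma>2"
  shows "antimono_on {0..1} (f \<circ> (\<gamma>1 +++ \<gamma>2) :: real \<Rightarrow> ereal)"
proof (rule monotone_onI)
  fix s t :: real assume st: "s \<in> {0..1}" "t \<in> {0..1}" "s \<le> t"
  have D1: "f (\<gamma>1 b) \<le> f (\<gamma>1 a)" if "0 \<le> a" "a \<le> b" "b \<le> 1" for a b
    using monotone_onD[OF 1, of a b] that by simp
  have D2: "f (\<gamma>2 b) \<le> f (\<gamma>2 a)" if "0 \<le> a" "a \<le> b" "b \<le> 1" for a b
    using monotone_onD[OF 2, of a b] that by simp
  consider "t \<le> 1/2" | "s \<le> 1/2" "1/2 < t" | "1/2 < s"
    using st by linarith
  then show "(f \<circ> (\<gamma>1 +++ \<gamma>2)) t \<le> (f \<circ> (\<gamma>1 +++ \<gamma>2)) s"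
  proof cases
    case 2
    have "f (\<gamma>2 (2 * t - 1)) \<le> f (\<gamma>2 0)" "f (\<gamma>1 1) \<le> f (\<gamma>1 (2 * s))"
      using 2 st by (auto intro: D1 D2)
    then show ?thesis
      using 2 join by (simp add: joinpaths_def pathfinish_def pathstart_def)
  qed (use st in \<open>auto simp: joinpaths_def intro: D1 D2\<close>)
qed

lemma descends_to_trans:
  assumes "descends_to f S x y" "descends_to f S y z"
  shows "descends_to f S x z"
proof -
  obtain \<gamma>1 \<gamma>2 where 1: "nonincreasing_path_in f S \<gamma>1" "pathstart \<gamma>1 = x" "pathfinish \<gamma>1 = y"
    and 2: "nonincreasing_path_in f S \<gamma>2" "pathstart \<gamma>2 = y" "pathfinish \<gamma>2 = z"
    using assms unfolding descends_to_def by blast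
  then have "nonincreasing_path_in f S (\<gamma>1 +++ \<gamma>2)"
    unfolding nonincreasing_path_in_def
    by (simp add: path_join path_image_join antimono_on_joinpaths)
  then show ?thesis
    using 1 2 unfolding descends_to_def by (intro exI[of _ "\<gamma>1 +++ \<gamma>2"]) simp
qed

text \<open>
  Write \<open>t = k' / k\<close>. The point with parameter \<open>k'\<close> on the segment from the current point to the minimum
  has a value that is at most the current one by convexity, and its regularizer is
  \<open>(1 - t) * \<rho>\<^sub>0 + t * \<rho>\<close>. The hypothesis on \<open>\<rho>'\<close> says that the new point does not lie above it.
\<close>

lemma moving_toward_minimum_descends:
  fixes l :: "'v::real_vector \<times> 'e::real_vector \<Rightarrow> real" and H :: "'e \<Rightarrow> real" and lam :: real
  defines "h \<equiv> \<lambda>x v q u k \<rho>. l (x - k *\<^sub>R v, q - k *\<^sub>R u) + lam * \<rho> + H (q - k *\<^sub>R u)"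
  assumes l: "convex_on UNIV l" and H: "convex_on UNIV H" and lam: "0 < lam"
    and k: "0 \<le> k'" "k' \<le> k" "0 < k"
    and cost: "(\<rho>' - \<rho>\<^sub>0) * k \<le> (\<rho> - \<rho>\<^sub>0) * k'"
    and min: "h x v q u 0 \<rho>\<^sub>0 \<le> h x v q u k \<rho>"
  shows "h x v q u k' \<rho>' \<le> h x v q u k \<rho>"
proof -
  define t where "t = k' / k"
  have t: "0 \<le> t" "t \<le> 1" "k' = t * k"
    using k by (auto simp: t_def)
  have "(1 - t) *\<^sub>R (x, q) + t *\<^sub>R (x - k *\<^sub>R v, q - k *\<^sub>R u) = (x - k' *\<^sub>R v, q - k' *\<^sub>R u)"
    unfolding t(3) by (simp add: algebra_simps)
  then have l': "l (x - k' *\<^sub>R v, q - k' *\<^sub>R u) \<le>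
      (1 - t) * l (x, q) + t * l (x - k *\<^sub>R v, q - k *\<^sub>R u)"
    using convex_onD[OF l t(1,2), of "(x, q)" "(x - k *\<^sub>R v, q - k *\<^sub>R u)"] by simp
  have "(1 - t) *\<^sub>R q + t *\<^sub>R (q - k *\<^sub>R u) = q - k' *\<^sub>R u"
    unfolding t(3) by (simp add: algebra_simps)
  then have H': "H (q - k' *\<^sub>R u) \<le> (1 - t) * H q + t * H (q - k *\<^sub>R u)"
    using convex_onD[OF H t(1,2), of q "q - k *\<^sub>R u"] by simp
  have "(\<rho>' - \<rho>\<^sub>0) * k \<le> (t * (\<rho> - \<rho>\<^sub>0)) * k"
    using cost t(3) by (simp add: algebra_simps)
  then have "\<rho>' - \<rho>\<^sub>0 \<le> t * (\<rho> - \<rho>\<^sub>0)"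
    using k(3) by (rule mult_right_le_imp_le)
  then have "\<rho>' \<le> (1 - t) * \<rho>\<^sub>0 + t * \<rho>"
    by (simp add: algebra_simps)
  then have "lam * \<rho>' \<le> lam * ((1 - t) * \<rho>\<^sub>0 + t * \<rho>)"
    using lam by simp
  then have "h x v q u k' \<rho>' \<le> (1 - t) * h x v q u 0 \<rho>\<^sub>0 + t * h x v q u k \<rho>"
    using l' H' unfolding h_def by (simp add: algebra_simps)
  also have "\<dots> \<le> (1 - t) * h x v q u k \<rho> + t * h x v q u k \<rho>"
    using min t(2) by (intro add_right_mono mult_left_mono) auto
  finally show ?thesis
    by (simp add: algebra_simps)
qed

section \<open>Realizing weights by factor sets\<close>

text \<open>
  The map \<open>\<sigma>\<close> tells which atom a slot carries. Slots with nonzero weight keep their atom, and the others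
  are redistributed so that all of \<open>T\<close> gets a slot.
\<close>

lemma rearrange_slots:
  fixes c :: "'j \<Rightarrow> real"
  assumes "finite J" "r \<le> card J" and \<sigma>: "\<sigma> ` {..<r} \<subseteq> J" "inj_on \<sigma> {..<r}"
    and supp: "{j \<in> J. c j \<noteq> 0} \<subseteq> \<sigma> ` {..<r}"
    and T: "{j \<in> J. c j \<noteq> 0} \<subseteq> T" "T \<subseteq> J" "card T \<le> r"
  obtains \<tau> where "\<tau> ` {..<r} \<subseteq> J" "inj_on \<tau> {..<r}" "T \<subseteq> \<tau> ` {..<r}"
    "\<And>i. i < r \<Longrightarrow> (c (\<sigma> i) = 0 \<and> c (\<tau> i) = 0) \<or> \<tau> i = \<sigma> i"
proof -
  define S where "S = {j \<in> J. c j \<noteq> 0}"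
  define P where "P = {i \<in> {..<r}. c (\<sigma> i) \<noteq> 0}"
  obtain U where U: "T \<subseteq> U" "U \<subseteq> J" "card U = r"
    using exists_subset_between[OF T(3) assms(2) T(2) assms(1)] by blast
  have "finite U"
    using U assms(1) finite_subset by blast
  have "S \<subseteq> U"
    using T(1) U(1) by (auto simp: S_def)
  have bij_P: "bij_betw \<sigma> P S"
    unfolding bij_betw_def
  proof
    show "inj_on \<sigma> P"
      using \<sigma>(2) by (rule inj_on_subset) (auto simp: P_def)
    show "\<sigma> ` P = S"
      using \<sigma>(1) supp by (auto simp: P_def S_def)
  qed
  have "card ({..<r} - P) = card (U - S)"
    using bij_betw_same_card[OF bij_P] U(3) \<open>S \<subseteq> U\<close> \<open>finite U\<close>
    by (subst (1 2) card_Diff_subset) (auto simp: P_def intro: finite_subset)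
  then obtain f where f: "bij_betw f ({..<r} - P) (U - S)"
    using finite_same_card_bij[of "{..<r} - P" "U - S"] \<open>finite U\<close> by auto
  define \<tau> where "\<tau> i = (if i \<in> P then \<sigma> i else f i)" for i
  have "bij_betw \<tau> P S"
    using bij_P by (rule bij_betw_cong[THEN iffD1, rotated]) (simp add: \<tau>_def)
  moreover have "bij_betw \<tau> ({..<r} - P) (U - S)"
    using f by (rule bij_betw_cong[THEN iffD1, rotated]) (simp add: \<tau>_def)
  ultimately have "bij_betw \<tau> (P \<union> ({..<r} - P)) (S \<union> (U - S))"
    by (rule bij_betw_combine) auto
  moreover have "P \<union> ({..<r} - P) = {..<r}" "S \<union> (U - S) = U"
    using \<open>S \<subseteq> U\<close> by (auto simp: P_def)
  ultimately have bij: "bij_betw \<tau> {..<r} U"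
    by simp
  show ?thesis
  proof (rule that)
    show "\<tau> ` {..<r} \<subseteq> J" "inj_on \<tau> {..<r}" "T \<subseteq> \<tau> ` {..<r}"
      using bij U by (auto simp: bij_betw_def)
    fix i assume "i < r"
    show "(c (\<sigma> i) = 0 \<and> c (\<tau> i) = 0) \<or> \<tau> i = \<sigma> i"
    proof (cases "i \<in> P")
      case False
      then have "f i \<in> U - S"
        using f \<open>i < r\<close> by (auto simp: bij_betw_def)
      then have "c (\<tau> i) = 0"
        using U(2) False by (auto simp: S_def \<tau>_def)
      then show ?thesis
        using False \<open>i < r\<close> by (auto simp: P_def)
    qed (simp add: \<tau>_def)
  qed
qed

text \<open>
  The assumption \<open>enough_atoms\<close> allows every slot to carry an atom, with weight zero if the slot is empty.
\<close>

locale factor_atoms = weighted_atoms J "\<lambda>j. \<phi> (atom j)" w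
  for J :: "'j set" and \<phi> :: "(nat \<Rightarrow> tensor) \<Rightarrow> real ^ 'd" and atom :: "'j \<Rightarrow> nat \<Rightarrow> tensor"
    and w :: "'j \<Rightarrow> real" +
  fixes Ds :: "nat list list" and g :: "(nat \<Rightarrow> tensor) \<Rightarrow> ennreal" and p :: real and r :: nat
  assumes degree_pos: "0 < p"
    and hom_map: "pos_homogeneous Ds scaleR p \<phi>"
    and hom_reg: "pos_homogeneous Ds (\<lambda>c y. ennreal c * y) p g"
    and atom_in: "\<And>j. j \<in> J \<Longrightarrow> atom j \<in> factor_tuples Ds"
    and reg_atom: "\<And>j. j \<in> J \<Longrightarrow> g (atom j) = ennreal (w j)"
    and enough_atoms: "r \<le> card J"
begin

definition slots :: "(nat \<Rightarrow> 'j) \<Rightarrow> ('j \<Rightarrow> real) \<Rightarrow> bool" where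
  "slots \<sigma> c \<longleftrightarrow> \<sigma> ` {..<r} \<subseteq> J \<and> inj_on \<sigma> {..<r} \<and> supp c \<subseteq> \<sigma> ` {..<r}"

definition configuration :: "(nat \<Rightarrow> 'j) \<Rightarrow> ('j \<Rightarrow> real) \<Rightarrow> nat \<Rightarrow> tensor" where
  "configuration \<sigma> c = stack r (\<lambda>i. scale_tuple (c (\<sigma> i) powr (1 / p)) (atom (\<sigma> i)))"

lemma configuration_in_factor_sets: "slots \<sigma> c \<Longrightarrow> configuration \<sigma> c \<in> factor_sets Ds r"
  unfolding configuration_def slots_def
  by (intro stack_in_factor_sets scale_in_factor_tuples atom_in) auto

lemma sum_over_slots:
  fixes f :: "'j \<Rightarrow> 'b::comm_monoid_add"
  assumes "slots \<sigma> c" "\<And>j. j \<in> J \<Longrightarrow> c j = 0 \<Longrightarrow> f j = 0"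
  shows "(\<Sum>i<r. f (\<sigma> i)) = (\<Sum>j\<in>J. f j)"
proof -
  have "(\<Sum>i<r. f (\<sigma> i)) = (\<Sum>j\<in>\<sigma> ` {..<r}. f j)"
    using assms(1) by (simp add: slots_def sum.reindex)
  also have "\<dots> = (\<Sum>j\<in>J. f j)"
    using assms finite_atoms by (intro sum.mono_neutral_left) (auto simp: slots_def supp_def)
  finally show ?thesis .
qed

lemma Phi_configuration:
  assumes "slots \<sigma> c" "c \<in> coefficients"
  shows "Phi \<phi> r (configuration \<sigma> c) = lincomb c"
proof -
  have "\<phi> (slice i (configuration \<sigma> c)) = c (\<sigma> i) *\<^sub>R \<phi> (atom (\<sigma> i))" if "i < r" for i
  proof -
    have "\<sigma> i \<in> J"
      using assms(1) that by (auto simp: slots_def)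
    then show ?thesis
      unfolding configuration_def slice_stack[OF that] using assms(2)
      by (intro pos_homogeneous_root[OF hom_map degree_pos] atom_in) (auto simp: coefficients_def)
  qed
  then have "Phi \<phi> r (configuration \<sigma> c) = (\<Sum>i<r. c (\<sigma> i) *\<^sub>R \<phi> (atom (\<sigma> i)))"
    unfolding Phi_def by simp
  also have "\<dots> = lincomb c"
    unfolding lincomb_def by (rule sum_over_slots[OF assms(1)]) simp
  finally show ?thesis .
qed

lemma sum_reg_configuration:
  assumes "slots \<sigma> c" "c \<in> coefficients"
  shows "sum_reg g r (configuration \<sigma> c) = ennreal (cost c)"
proof -
  have nonneg: "0 \<le> c j" "0 \<le> w j" if "j \<in> J" for j
    using assms(2) that weight_nonneg by (auto simp: coefficients_def)
  have "g (slice i (configuration \<sigma> c)) = ennreal (c (\<sigma> i) * w (\<sigma> i))" if "i < r" for i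
  proof -
    have "\<sigma> i \<in> J"
      using assms(1) that by (auto simp: slots_def)
    then show ?thesis
      unfolding configuration_def slice_stack[OF that]
      by (subst pos_homogeneous_root[OF hom_reg degree_pos])
        (auto simp: atom_in reg_atom nonneg ennreal_mult)
  qed
  then have "sum_reg g r (configuration \<sigma> c) = (\<Sum>i<r. ennreal (c (\<sigma> i) * w (\<sigma> i)))"
    unfolding sum_reg_def by simp
  also have "\<dots> = (\<Sum>j\<in>J. ennreal (c j * w j))"
    by (rule sum_over_slots[OF assms(1)]) simp
  also have "\<dots> = ennreal (cost c)"
    unfolding cost_def by (rule sum_ennreal) (simp add: nonneg)
  finally show ?thesis .
qed

lemma factor_objective_configuration:
  assumes "slots \<sigma> c" "c \<in> coefficients"
  shows "factor_objective \<phi> g l lam H r (configuration \<sigma> c, Q) =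
    ereal (l (lincomb c, Q) + lam * cost c + H Q)"
  using cost_nonneg[of c] assms(2)
  by (simp add: factor_objective_def Phi_configuration[OF assms] sum_reg_configuration[OF assms]
      coefficients_def enn2ereal_ennreal)

text \<open>
  Only the scalar factors depend on \<open>t\<close>, and \<open>u powr (1 / p)\<close> is continuous up to \<open>u = 0\<close> because
  \<open>p > 0\<close>.
\<close>

lemma path_configuration:
  assumes "\<sigma> ` {..<r} \<subseteq> J" "c \<in> coefficients" "c' \<in> coefficients"
  shows "continuous_on {0..1} (\<lambda>t. configuration \<sigma> (\<lambda>j. (1 - t) * c j + t * c' j))"
proof (intro continuous_on_coordinatewise_then_product)
  fix k js
  show "continuous_on {0..1} (\<lambda>t. configuration \<sigma> (\<lambda>j. (1 - t) * c j + t * c' j) k js)"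
  proof (cases "js \<noteq> [] \<and> last js < r")
    case True
    then have "\<sigma> (last js) \<in> J"
      using assms(1) by auto
    then have "0 \<le> c (\<sigma> (last js))" "0 \<le> c' (\<sigma> (last js))"
      using assms(2,3) by (auto simp: coefficients_def)
    then show ?thesis
      using True degree_pos
      by (auto simp: configuration_def stack_def scale_tuple_def
          intro!: continuous_intros continuous_on_powr')
  next
    case False
    then show ?thesis
      unfolding configuration_def stack_def by (simp only: if_False continuous_on_const)
  qed
qed

text \<open>
  Replacing an atom of weight zero does not change the factor set, so this rearrangement costs no motion.
\<close>

lemma rearranged_configuration:
  assumes "slots \<sigma> c" "supp c \<subseteq> T" "T \<subseteq> J" "card T \<le> r"
  obtains \<tau> where "slots \<tau> c" "T \<subseteq> \<tau> ` {..<r}" "configuration \<tau> c = configuration \<sigma> c"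
proof -
  obtain \<tau> where \<tau>: "\<tau> ` {..<r} \<subseteq> J" "inj_on \<tau> {..<r}" "T \<subseteq> \<tau> ` {..<r}"
    and same: "\<And>i. i < r \<Longrightarrow> (c (\<sigma> i) = 0 \<and> c (\<tau> i) = 0) \<or> \<tau> i = \<sigma> i"
    using rearrange_slots[OF finite_atoms enough_atoms, of \<sigma> c T] assms
    unfolding slots_def supp_def by metis
  have "scale_tuple (c (\<tau> i) powr (1 / p)) (atom (\<tau> i)) =
      scale_tuple (c (\<sigma> i) powr (1 / p)) (atom (\<sigma> i))" if "i < r" for i
    using same[OF that] by (auto simp: scale_tuple_def)
  then have "configuration \<tau> c = configuration \<sigma> c"
    unfolding configuration_def stack_def by (auto simp: fun_eq_iff)
  then show ?thesis
    using that \<tau> assms(2) unfolding slots_def by blast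
qed

text \<open>
  Moving the weights along a straight segment moves \<open>X\<close>, \<open>Q\<close> and the regularizer linearly. The cost
  condition on the end points is the sign of a \<open>2 \<times> 2\<close> determinant in \<open>(cost - \<rho>, k)\<close>, which on a segment is
  \<open>t - s\<close> times its value at the end points; hence it holds between any two times \<open>s \<le> t\<close>.
\<close>

lemma reweighting_descends:
  fixes l :: "(real ^ 'd) \<times> 'e::real_normed_vector \<Rightarrow> real" and H :: "'e \<Rightarrow> real" and lam \<rho> :: real
  defines "f \<equiv> factor_objective \<phi> g l lam H r"
  assumes convex: "convex_on UNIV l" "convex_on UNIV H" "0 < lam"
    and bound: "\<And>Z Q. Z \<in> factor_sets Ds r \<Longrightarrow> ereal (l (x, q) + lam * \<rho> + H q) \<le> f (Z, Q)"
    and \<sigma>: "slots \<sigma> c" and c: "c \<in> coefficients" "lincomb c = x - k *\<^sub>R v"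
    and c': "c' \<in> coefficients" "lincomb c' = x - k' *\<^sub>R v"
    and card: "card (supp c \<union> supp c') \<le> r"
    and k: "0 < k" "0 \<le> k'" "k' \<le> k"
    and cost: "(cost c' - \<rho>) * k \<le> (cost c - \<rho>) * k'"
  obtains \<tau> where "slots \<tau> c'"
    "descends_to f (factor_sets Ds r \<times> UNIV)
       (configuration \<sigma> c, q - k *\<^sub>R u) (configuration \<tau> c', q - k' *\<^sub>R u)"
proof -
  obtain \<tau> where \<tau>: "slots \<tau> c" "supp c \<union> supp c' \<subseteq> \<tau> ` {..<r}"
    and same: "configuration \<tau> c = configuration \<sigma> c"
    using rearranged_configuration[OF \<sigma>, of "supp c \<union> supp c'"] card supp_subset by blast
  define C where "C t = (\<lambda>j. (1 - t) * c j + t * c' j)" for t :: real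
  define K where "K t = (1 - t) * k + t * k'" for t
  define \<gamma> where "\<gamma> t = (configuration \<tau> (C t), q - K t *\<^sub>R u)" for t
  have C: "slots \<tau> (C t)" "C t \<in> coefficients" "lincomb (C t) = x - K t *\<^sub>R v"
    "cost (C t) = (1 - t) * cost c + t * cost c'" if "t \<in> {0..1}" for t
  proof -
    have "supp (C t) \<subseteq> supp c \<union> supp c'"
      by (auto simp: C_def supp_def)
    then show "slots \<tau> (C t)"
      using \<tau> unfolding slots_def by blast
    show "C t \<in> coefficients"
      using c(1) c'(1) that by (auto simp: coefficients_def C_def)
    show "lincomb (C t) = x - K t *\<^sub>R v"
      unfolding C_def lincomb_convex c(2) c'(2) K_def by (simp add: algebra_simps)
    show "cost (C t) = (1 - t) * cost c + t * cost c'"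
      unfolding C_def cost_convex ..
  qed
  have in_S: "configuration \<tau> (C t) \<in> factor_sets Ds r" if "t \<in> {0..1}" for t
    using C(1)[OF that] by (rule configuration_in_factor_sets)
  define h where "h \<kappa> \<rho>' = l (x - \<kappa> *\<^sub>R v, q - \<kappa> *\<^sub>R u) + lam * \<rho>' + H (q - \<kappa> *\<^sub>R u)" for \<kappa> \<rho>'
  have f_\<gamma>: "f (\<gamma> t) = ereal (h (K t) (cost (C t)))" if "t \<in> {0..1}" for t
    unfolding f_def \<gamma>_def h_def factor_objective_configuration[OF C(1,2)[OF that]] C(3)[OF that] ..
  have lower: "h 0 \<rho> \<le> h (K t) (cost (C t))" if "t \<in> {0..1}" for t
    using bound[OF in_S[OF that], of "q - K t *\<^sub>R u"] f_\<gamma>[OF that] by (simp add: \<gamma>_def h_def)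
  have anti: "antimono_on {0..1} (f \<circ> \<gamma>)"
  proof (rule monotone_onI)
    fix s t :: real assume st: "s \<in> {0..1}" "t \<in> {0..1}" "s \<le> t"
    show "(f \<circ> \<gamma>) t \<le> (f \<circ> \<gamma>) s"
    proof (cases "s = t")
      case False
      then have "0 < K s"
        using st k by (auto simp: K_def intro: add_pos_nonneg)
      moreover have "0 \<le> K t"
        using st k by (simp add: K_def)
      moreover have "(t - s) * k' \<le> (t - s) * k"
        using st k by (intro mult_left_mono) auto
      then have "K t \<le> K s"
        by (simp add: K_def algebra_simps)
      moreover have "(t - s) * ((cost c' - \<rho>) * k) \<le> (t - s) * ((cost c - \<rho>) * k')"
        using st cost by (intro mult_left_mono) auto
      then have "(cost (C t) - \<rho>) * K s \<le> (cost (C s) - \<rho>) * K t"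
        unfolding C(4)[OF st(1)] C(4)[OF st(2)] K_def by (simp add: algebra_simps)
      ultimately have "h (K t) (cost (C t)) \<le> h (K s) (cost (C s))"
        using moving_toward_minimum_descends[OF convex, where k' = "K t" and k = "K s"
            and \<rho>' = "cost (C t)" and \<rho>\<^sub>0 = \<rho> and \<rho> = "cost (C s)"
            and x = x and v = v and q = q and u = u]
          lower[OF st(1)] \<open>K t \<le> K s\<close> by (simp add: h_def)
      then show ?thesis
        using f_\<gamma> st by simp
    qed simp
  qed
  have "continuous_on {0..1} \<gamma>"
    unfolding \<gamma>_def C_def K_def
    using path_configuration[of \<tau> c c'] \<tau>(1) c(1) c'(1)
    by (intro continuous_on_Pair) (auto simp: slots_def intro!: continuous_intros)
  then have "nonincreasing_path_in f (factor_sets Ds r \<times> UNIV) \<gamma>"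
    unfolding nonincreasing_path_in_def using anti in_S
    by (auto simp: path_def path_image_def \<gamma>_def)
  moreover have "pathstart \<gamma> = (configuration \<sigma> c, q - k *\<^sub>R u)"
    "pathfinish \<gamma> = (configuration \<tau> c', q - k' *\<^sub>R u)"
    using same by (simp_all add: pathstart_def pathfinish_def \<gamma>_def C_def K_def)
  moreover have "slots \<tau> c'"
    using \<tau> by (auto simp: slots_def)
  ultimately show ?thesis
    using that unfolding descends_to_def by blast
qed

end

section \<open>Descent to a global minimizer\<close>

lemma sum_lessThan_add:
  fixes f :: "nat \<Rightarrow> 'a::comm_monoid_add"
  shows "(\<Sum>j<m + n. f j) = (\<Sum>j<m. f j) + (\<Sum>i<n. f (m + i))"
  by (induction n) (simp_all add: add.assoc)

theorem theorem17:
  fixes Ds :: "nat list list"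
    and \<phi> :: "(nat \<Rightarrow> tensor) \<Rightarrow> real ^ 'd"
    and g :: "(nat \<Rightarrow> tensor) \<Rightarrow> ennreal"
    and l :: "(real ^ 'd) \<times> 'e::real_normed_vector \<Rightarrow> real"
    and H :: "'e \<Rightarrow> real"
    and lam :: real and r :: nat
    and Xmin :: "real ^ 'd" and Qmin :: 'e
    and Z :: "nat \<Rightarrow> tensor" and Q :: 'e
  assumes E_finite_dim: "\<exists>B :: 'e set. finite B \<and> span B = UNIV"
    and mapping: "elemental_mapping Ds \<phi>"
    and regularizer: "elemental_regularizer Ds g"
    and nondeg: "nondegenerate_pair Ds \<phi> g"
    and l_diff: "l differentiable_on UNIV"
    and l_convex: "convex_on UNIV l"
    and H_convex: "convex_on UNIV H"
    and lam_pos: "lam > 0"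
    and F_min: "global_minimizer_on (convex_objective Ds \<phi> g l lam H) UNIV (Xmin, Qmin)"
    and Omega_min: "Omega_attained Ds \<phi> g Xmin"
    and r_large: "r > CARD('d)"
    and start: "Z \<in> factor_sets Ds r"
    and finite_start: "factor_objective \<phi> g l lam H r (Z, Q) < \<infinity>"
  shows "\<exists>\<gamma>. nonincreasing_path_in (factor_objective \<phi> g l lam H r) (factor_sets Ds r \<times> UNIV) \<gamma>
           \<and> pathstart \<gamma> = (Z, Q)
           \<and> global_minimizer_on (factor_objective \<phi> g l lam H r) (factor_sets Ds r \<times> UNIV)
               (pathfinish \<gamma>)"
proof -
  let ?f = "factor_objective \<phi> g l lam H r" and ?F = "convex_objective Ds \<phi> g l lam H"
  let ?S = "factor_sets Ds r \<times> (UNIV :: 'e set)"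
  obtain p where p: "p \<noteq> 0" "pos_homogeneous Ds (\<lambda>c y. ennreal c * y) p g"
      "pos_homogeneous Ds scaleR p \<phi>"
    using nondeg unfolding nondegenerate_pair_def by blast
  then have "0 < p"
    by (simp add: pos_homogeneous_def)
  obtain s W where W: "W \<in> factor_sets Ds s" "Phi \<phi> s W = Xmin" "sum_reg g s W = Omega Ds \<phi> g Xmin"
    using Omega_min unfolding Omega_attained_def by blast
  have F_le: "?F (Xmin, Qmin) \<le> ?f (Z', Q')" if "Z' \<in> factor_sets Ds r" for Z' Q'
  proof -
    have "?F (Xmin, Qmin) \<le> ?F (Phi \<phi> r Z', Q')"
      using F_min unfolding global_minimizer_on_def by blast
    also have "\<dots> \<le> ?f (Z', Q')"
      using that r_large lam_pos by (intro convex_objective_le_factor_objective) auto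
    finally show ?thesis .
  qed
  have fin_Z: "sum_reg g r Z \<noteq> top"
    using finite_start lam_pos by (auto simp: factor_objective_def enn2ereal_top)
  have "?F (Xmin, Qmin) < \<infinity>"
    using F_le[OF start] finite_start by (rule le_less_trans)
  then have fin_W: "sum_reg g s W \<noteq> top"
    using lam_pos by (auto simp: convex_objective_def W(3) enn2ereal_top)
  \<comment> \<open>The atoms are the slices of \<open>Z\<close>, followed by those of the optimal factorization \<open>W\<close>.\<close>
  define J where "J = {..<r + s}"
  define atom where "atom j = (if j < r then slice j Z else slice (j - r) W)" for j
  define w where "w j = enn2real (g (atom j))" for j
  have fin_atom: "g (atom j) \<noteq> top" if "j \<in> J" for j
  proof (cases "j < r")
    case True
    then show ?thesis
      using fin_Z by (auto simp: atom_def sum_reg_def)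
  next
    case False
    then have "j - r < s"
      using that by (auto simp: J_def)
    then show ?thesis
      using fin_W False by (auto simp: atom_def sum_reg_def)
  qed
  interpret factor_atoms J \<phi> atom w Ds g p r
  proof
    fix j assume j: "j \<in> J"
    show "atom j \<in> factor_tuples Ds"
      using j slice_in_factor_tuples[OF start] slice_in_factor_tuples[OF W(1)]
      by (auto simp: atom_def J_def)
    show "g (atom j) = ennreal (w j)"
      using fin_atom[OF j] by (simp add: w_def less_top)
  qed (use p \<open>0 < p\<close> in \<open>auto simp: J_def w_def\<close>)
  \<comment> \<open>\<open>c0\<close> are the weights of \<open>Z\<close> and \<open>d\<close> those of \<open>W\<close>. The latter need not fit into \<open>r\<close> slots.\<close>
  define c0 where "c0 j = (if j < r then 1 else 0 :: real)" for j
  define d where "d j = (if r \<le> j \<and> j < r + s then 1 else 0 :: real)" for j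
  have coeffs: "c0 \<in> coefficients" "d \<in> coefficients"
    unfolding coefficients_def by (auto simp: c0_def d_def J_def)
  have lincomb_c0: "lincomb c0 = Phi \<phi> r Z"
    unfolding lincomb_def unfolding J_def sum_lessThan_add by (simp add: c0_def atom_def Phi_def)
  have lincomb_d: "lincomb d = Xmin"
    unfolding lincomb_def unfolding J_def sum_lessThan_add W(2)[symmetric]
    by (simp add: d_def atom_def Phi_def)
  have cost_d: "ennreal (cost d) = Omega Ds \<phi> g Xmin"
  proof -
    have "cost d = (\<Sum>i<s. w (r + i))"
      unfolding cost_def unfolding J_def sum_lessThan_add by (simp add: d_def)
    also have "ennreal \<dots> = (\<Sum>i<s. ennreal (w (r + i)))"
      by (simp add: sum_ennreal w_def)
    also have "\<dots> = (\<Sum>i<s. g (slice i W))"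
      by (intro sum.cong refl) (simp add: reg_atom[symmetric] J_def atom_def)
    finally show ?thesis
      using W(3) by (simp add: sum_reg_def)
  qed
  have F_eq: "?F (Xmin, Qmin) = ereal (l (Xmin, Qmin) + lam * cost d + H Qmin)"
    using cost_nonneg[of d] coeffs(2)
    by (simp add: convex_objective_def cost_d[symmetric] coefficients_def enn2ereal_ennreal)
  have slots_c0: "slots id c0"
    unfolding slots_def supp_def by (auto simp: J_def c0_def)
  have conf_c0: "configuration id c0 = Z"
  proof -
    have "scale_tuple (c0 (id i) powr (1 / p)) (atom (id i)) = slice i Z" if "i < r" for i
      using that by (simp add: c0_def atom_def scale_tuple_def)
    then have "configuration id c0 = stack r (\<lambda>i. slice i Z)"
      unfolding configuration_def stack_def by (auto simp: fun_eq_iff)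
    then show ?thesis
      using stack_slices[OF start] by simp
  qed
  define v where "v = Xmin - Phi \<phi> r Z"
  define u where "u = Qmin - Q"
  define R where "R k c \<longleftrightarrow> (\<exists>\<sigma>. slots \<sigma> c \<and>
      descends_to ?f ?S (Z, Q) (configuration \<sigma> c, Qmin - k *\<^sub>R u))" for k c
  obtain c where c: "R 0 c" "c \<in> coefficients" "lincomb c = Xmin" "cost c \<le> cost d"
  proof (rule pivoting_reaches_end[of R c0 Xmin v r d])
    show "R 1 c0"
      unfolding R_def using slots_c0 conf_c0 start
      by (intro exI[of _ id]) (auto simp: u_def intro: descends_to_refl)
    show "lincomb c0 = Xmin - v"
      by (simp add: v_def lincomb_c0)
    have "supp c0 \<subseteq> {..<r}"
      by (auto simp: supp_def c0_def)
    then show "card (supp c0) \<le> r"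
      using card_mono[of "{..<r}"] by auto
    show "DIM(real ^ 'd) < r"
      using r_large by simp
  next
    fix k c k' c'
    assume R: "R k c" and step: "c \<in> coefficients" "lincomb c = Xmin - k *\<^sub>R v" "c' \<in> coefficients"
      "lincomb c' = Xmin - k' *\<^sub>R v" "card (supp c \<union> supp c') \<le> r" "0 < k" "0 \<le> k'" "k' \<le> k"
      "(cost c' - cost d) * k \<le> (cost c - cost d) * k'"
    obtain \<sigma> where \<sigma>: "slots \<sigma> c" "descends_to ?f ?S (Z, Q) (configuration \<sigma> c, Qmin - k *\<^sub>R u)"
      using R unfolding R_def by blast
    have "ereal (l (Xmin, Qmin) + lam * cost d + H Qmin) \<le> ?f (Z', Q')" if "Z' \<in> factor_sets Ds r" for Z' Q'
      using F_le[OF that] F_eq by simp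
    then obtain \<tau> where "slots \<tau> c'" "descends_to ?f ?S
        (configuration \<sigma> c, Qmin - k *\<^sub>R u) (configuration \<tau> c', Qmin - k' *\<^sub>R u)"
      using reweighting_descends[OF l_convex H_convex lam_pos _ \<sigma>(1) step] by blast
    then show "R k' c'"
      using descends_to_trans[OF \<sigma>(2)] unfolding R_def by blast
  qed (use coeffs lincomb_d in auto)
  obtain \<sigma> where \<sigma>: "slots \<sigma> c" "descends_to ?f ?S (Z, Q) (configuration \<sigma> c, Qmin)"
    using c(1) unfolding R_def by auto
  have "?f (configuration \<sigma> c, Qmin) \<le> ?F (Xmin, Qmin)"
    using c(4) lam_pos
    unfolding factor_objective_configuration[OF \<sigma>(1) c(2)] F_eq c(3) by simp
  then have "?f (configuration \<sigma> c, Qmin) \<le> ?f y" if "y \<in> ?S" for y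
    using F_le[of "fst y" "snd y"] that by (cases y) (auto intro: order_trans)
  then have "global_minimizer_on ?f ?S (configuration \<sigma> c, Qmin)"
    using configuration_in_factor_sets[OF \<sigma>(1)] unfolding global_minimizer_on_def by blast
  then show ?thesis
    using \<sigma>(2) unfolding descends_to_def by metis
qed

end
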